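(* Suppose that the function $g\in BB(\mathbb{R})$ is continuous at every point of the bounded open interval $(a,b)$. Suppose further that the function $F:[a,b]\to\mathbb{R}$ is continuous (including one-sidedly at the endpoints) and is differentiable and satisfies $F'(t)=g(t)$ at every point $t\in(a,b)$. Then $$\int_{\mathbb{R}}g\chi_{(a,b)}=F(b)-F(a).$$
   Context: For an integer $k\ge 0$, $D_{k}(\mathbb{R})$ is the collection of all semiclosed dyadic intervals $[n2^{-k},(n+1)2^{-k})$ with $n\in\mathbb{Z}$. $BB(\mathbb{R})$ is the set of bounded functions $f:\mathbb{R}\to\mathbb{R}$ which vanish outside some bounded set. For $f\in BB(\mathbb{R})$ set $U_{k}(f)=2^{-k}\sum_{I\in D_{k}(\mathbb{R})}\sup_{p\in I}f(p)$ and $L_{k}(f)=2^{-k}\sum_{I\in D_{k}(\mathbb{R})}\inf_{p\in I}f(p)$ (only finitely many terms are non-zero). The sequences $U_k(f)$ and $L_k(f)$ are bounded and, respectively, non-increasing and non-decreasing in $k$, so they converge. A function $f\in BB(\mathbb{R})$ is (dyadically) Riemann integrable, written $f\in RI(\mathbb{R})$, if $\lim_{k\to\infty}U_{k}(f)=\lim_{k\to\infty}L_{k}(f)$; the common value is denoted $\int_{\mathbb{R}}f$. Writing $\int_{\mathbb{R}}f$ includes the assertion that $f\in RI(\mathbb{R})$. $\chi_{E}$ denotes the characteristic (indicator) function of $E$. *)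

theory Defs
  imports "HOL-Analysis.Analysis"
begin

definition dyadic_intervals :: "nat \<Rightarrow> real set set" where
  "dyadic_intervals k = {{real_of_int n / 2 ^ k ..< (real_of_int n + 1) / 2 ^ k} | n::int. True}"

definition BB :: "(real \<Rightarrow> real) set" where
  "BB = {f. bounded (range f) \<and> (\<exists>S. bounded S \<and> (\<forall>x. x \<notin> S \<longrightarrow> f x = 0))}"

text \<open>For \<open>f \<in> BB\<close> every supremum and infimum below is over a nonempty bounded set of reals,
  and only finitely many terms are nonzero, so the unordered sum is a finite one. Outside
  \<open>BB\<close> the values carry no meaning.\<close>

definition upper_dyadic_sum :: "(real \<Rightarrow> real) \<Rightarrow> nat \<Rightarrow> real" where
  "upper_dyadic_sum f k = (\<Sum>\<^sub>\<infinity>I\<in>dyadic_intervals k. SUP p\<in>I. f p) / 2 ^ k"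

definition lower_dyadic_sum :: "(real \<Rightarrow> real) \<Rightarrow> nat \<Rightarrow> real" where
  "lower_dyadic_sum f k = (\<Sum>\<^sub>\<infinity>I\<in>dyadic_intervals k. INF p\<in>I. f p) / 2 ^ k"

text \<open>The limits are required to exist explicitly, because \<^const>\<open>lim\<close> has an
  arbitrary value on divergent sequences.\<close>

definition RI :: "(real \<Rightarrow> real) set" where
  "RI = {f \<in> BB. convergent (upper_dyadic_sum f) \<and> convergent (lower_dyadic_sum f) \<and>
                 lim (upper_dyadic_sum f) = lim (lower_dyadic_sum f)}"

definition dyadic_integral :: "(real \<Rightarrow> real) \<Rightarrow> real" where
  "dyadic_integral f = lim (upper_dyadic_sum f)"

end

theory Submission
  imports Defs
begin

text \<open>
  The upper dyadic sum of \<open>f\<close> is the Lebesgue integral of the step function which on each dyadic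
  interval of length \<open>1 / 2 ^ k\<close> takes the supremum of \<open>f\<close> there. At a point where \<open>f\<close> is
  continuous these step functions tend to the value of \<open>f\<close>, and for \<open>f \<in> BB\<close> they share a bound and
  a bounded support. Dominated convergence therefore shows that the upper sums of a Borel function
  in \<open>BB\<close> which is continuous almost everywhere tend to its Lebesgue integral
  (\<open>upper_dyadic_sum_tendsto_lborel\<close>). Replacing \<open>f\<close> by \<open>- f\<close> turns upper into lower sums, so such
  a function is dyadically integrable and the dyadic integral is the Lebesgue integral
  (\<open>dyadic_integral_eq_lborel\<close>).

  The function \<open>g * indicator {a<..<b}\<close> is of this kind, with \<open>a\<close> and \<open>b\<close> as its only possible
  discontinuities. Its Lebesgue integral is also its Henstock--Kurzweil integral, and for the latter
  the fundamental theorem of calculus needs a continuous antiderivative that is differentiable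
  inside the interval only.
\<close>

definition dyadic_interval :: "nat \<Rightarrow> int \<Rightarrow> real set" where
  "dyadic_interval k n = {real_of_int n / 2 ^ k ..< (real_of_int n + 1) / 2 ^ k}"

definition upper_step :: "(real \<Rightarrow> real) \<Rightarrow> nat \<Rightarrow> real \<Rightarrow> real" where
  "upper_step f k x = (SUP p\<in>dyadic_interval k \<lfloor>2 ^ k * x\<rfloor>. f p)"

lemma mem_dyadic_interval_iff: "x \<in> dyadic_interval k n \<longleftrightarrow> \<lfloor>2 ^ k * x\<rfloor> = n"
  by (auto simp: dyadic_interval_def floor_eq_iff field_simps)

lemma mem_dyadic_interval_floor: "x \<in> dyadic_interval k \<lfloor>2 ^ k * x\<rfloor>"
  by (simp add: mem_dyadic_interval_iff)

lemma dyadic_interval_nonempty: "dyadic_interval k n \<noteq> {}"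
  by (simp add: dyadic_interval_def divide_strict_right_mono)

lemma dyadic_interval_diameter:
  assumes "x \<in> dyadic_interval k n" "y \<in> dyadic_interval k n"
  shows "\<bar>x - y\<bar> < 1 / 2 ^ k"
  using assms by (auto simp: dyadic_interval_def add_divide_distrib)

lemma inj_dyadic_interval: "inj (dyadic_interval k)"
  by (metis dyadic_interval_nonempty ex_in_conv injI mem_dyadic_interval_iff)

lemma dyadic_intervals_eq_range: "dyadic_intervals k = range (dyadic_interval k)"
  by (auto simp: dyadic_intervals_def dyadic_interval_def)

lemma BB_boundedD:
  assumes "f \<in> BB"
  shows "\<exists>M. \<forall>x. \<bar>f x\<bar> \<le> M" "\<exists>N::nat. \<forall>x. \<bar>x\<bar> > real N \<longrightarrow> f x = 0"
proof -
  from assms obtain S where S: "bounded (range f)" "bounded S" "\<And>x. x \<notin> S \<Longrightarrow> f x = 0"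
    by (auto simp: BB_def)
  from S(1) show "\<exists>M. \<forall>x. \<bar>f x\<bar> \<le> M"
    by (auto simp: bounded_iff)
  from S(2) obtain B where B: "\<And>x. x \<in> S \<Longrightarrow> \<bar>x\<bar> \<le> B"
    by (auto simp: bounded_iff)
  obtain N :: nat where "B \<le> real N"
    using real_arch_simple by blast
  with B S(3) have "f x = 0" if "\<bar>x\<bar> > real N" for x
    using that by force
  then show "\<exists>N::nat. \<forall>x. \<bar>x\<bar> > real N \<longrightarrow> f x = 0"
    by blast
qed

lemma BB_uminus: "f \<in> BB \<Longrightarrow> (\<lambda>x. - f x) \<in> BB"
  by (auto simp: BB_def bounded_iff)

lemma upper_step_eq_0:
  assumes "\<And>y. \<bar>y\<bar> > R \<Longrightarrow> f y = 0" "\<bar>x\<bar> > R + 1"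
  shows "upper_step f k x = 0"
proof -
  have "f p = 0" if "p \<in> dyadic_interval k \<lfloor>2 ^ k * x\<rfloor>" for p
  proof -
    have "\<bar>x - p\<bar> < 1 / 2 ^ k"
      using dyadic_interval_diameter[OF mem_dyadic_interval_floor that] .
    also have "\<dots> \<le> 1"
      by simp
    finally show ?thesis
      using assms by auto
  qed
  then have "upper_step f k x = (SUP p\<in>dyadic_interval k \<lfloor>2 ^ k * x\<rfloor>. 0)"
    unfolding upper_step_def by (intro SUP_cong) auto
  then show ?thesis
    using dyadic_interval_nonempty by simp
qed

lemma upper_step_tendsto:
  assumes "isCont f x"
  shows "(\<lambda>k. upper_step f k x) \<longlonglongrightarrow> f x"
proof (rule LIMSEQ_I)
  fix e :: real assume "e > 0"
  with assms obtain d where d: "d > 0" "\<And>y. \<bar>y - x\<bar> < d \<Longrightarrow> \<bar>f y - f x\<bar> < e / 2"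
    unfolding continuous_at_eps_delta dist_real_def by (meson half_gt_zero)
  from d(1) obtain K where K: "(1 / 2 :: real) ^ K < d"
    using real_arch_pow_inv[of d "1 / 2"] by auto
  have "\<bar>upper_step f k x - f x\<bar> \<le> e / 2" if "k \<ge> K" for k
    unfolding upper_step_def
  proof (rule cSup_asclose)
    have "1 / 2 ^ k \<le> (1 / 2 :: real) ^ K"
      using that power_decreasing[of K k "1 / 2 :: real"] by (simp add: power_one_over)
    with K have "\<bar>p - x\<bar> < d" if "p \<in> dyadic_interval k \<lfloor>2 ^ k * x\<rfloor>" for p
      using dyadic_interval_diameter[OF that mem_dyadic_interval_floor] by linarith
    then show "\<forall>y\<in>f ` dyadic_interval k \<lfloor>2 ^ k * x\<rfloor>. \<bar>y - f x\<bar> \<le> e / 2"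
      using d(2) by (auto intro: less_imp_le)
  qed (simp add: dyadic_interval_nonempty)
  with \<open>e > 0\<close> show "\<exists>K. \<forall>k\<ge>K. norm (upper_step f k x - f x) < e"
    by (intro exI[of _ K]) force
qed

text \<open>Outside a bounded set the suprema vanish, so both the unordered sum and the step function
  reduce to finitely many dyadic intervals, each of measure \<open>1 / 2 ^ k\<close>.\<close>

lemma has_bochner_integral_upper_step:
  assumes "f \<in> BB"
  shows "has_bochner_integral lborel (upper_step f k) (upper_dyadic_sum f k)"
proof -
  from BB_boundedD(2)[OF assms] obtain N :: nat where N: "\<And>x. \<bar>x\<bar> > real N \<Longrightarrow> f x = 0"
    by auto
  define s where "s n = (SUP p\<in>dyadic_interval k n. f p)" for n
  \<comment> \<open>The index of every dyadic interval that meets \<open>[- N - 1, N + 1]\<close> lies in \<open>A\<close>.\<close>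
  define A where "A = {\<lfloor>2 ^ k * (- real N - 1)\<rfloor> .. \<lfloor>2 ^ k * (real N + 1)\<rfloor>}"
  have s_0: "s n = 0" if "n \<notin> A" for n
  proof -
    obtain x where x: "x \<in> dyadic_interval k n"
      using dyadic_interval_nonempty by blast
    then have n: "\<lfloor>2 ^ k * x\<rfloor> = n"
      by (simp add: mem_dyadic_interval_iff)
    have "\<bar>x\<bar> > real N + 1"
    proof (rule ccontr)
      assume "\<not> \<bar>x\<bar> > real N + 1"
      then have "- real N - 1 \<le> x" "x \<le> real N + 1"
        by auto
      then have "n \<in> A"
        unfolding A_def n[symmetric] by (auto intro!: floor_mono)
      with that show False ..
    qed
    then have "upper_step f k x = 0"
      by (intro upper_step_eq_0[where R = "real N"] N)
    then show ?thesis
      by (simp add: upper_step_def s_def n)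
  qed
  have "upper_dyadic_sum f k = (\<Sum>\<^sub>\<infinity>n. s n) / 2 ^ k"
    by (simp add: upper_dyadic_sum_def dyadic_intervals_eq_range s_def o_def
        infsum_reindex[OF inj_dyadic_interval])
  also have "(\<Sum>\<^sub>\<infinity>n. s n) = (\<Sum>\<^sub>\<infinity>n\<in>A. s n)"
    by (rule infsum_cong_neutral) (auto simp: s_0)
  also have "\<dots> = (\<Sum>n\<in>A. s n)"
    by (simp add: A_def)
  finally have sum: "upper_dyadic_sum f k = (\<Sum>n\<in>A. measure lborel (dyadic_interval k n) * s n)"
    by (simp add: dyadic_interval_def sum_divide_distrib divide_right_mono add_divide_distrib)
  have step: "upper_step f k = (\<lambda>x. \<Sum>n\<in>A. indicator (dyadic_interval k n) x * s n)"
  proof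
    fix x
    have "(\<Sum>n\<in>A. indicator (dyadic_interval k n) x * s n)
        = (\<Sum>n\<in>A. if n = \<lfloor>2 ^ k * x\<rfloor> then s n else 0)"
      by (intro sum.cong) (auto simp: indicator_def mem_dyadic_interval_iff)
    also have "\<dots> = s \<lfloor>2 ^ k * x\<rfloor>"
      using s_0[of "\<lfloor>2 ^ k * x\<rfloor>"] by (auto simp: A_def)
    finally show "upper_step f k x = (\<Sum>n\<in>A. indicator (dyadic_interval k n) x * s n)"
      by (simp add: upper_step_def s_def)
  qed
  show ?thesis
    unfolding sum step
    by (intro has_bochner_integral_sum has_bochner_integral_mult_left
        has_bochner_integral_real_indicator)
      (auto simp: dyadic_interval_def divide_right_mono)
qed

lemma upper_dyadic_sum_tendsto_lborel:
  assumes "f \<in> BB" "f \<in> borel_measurable borel" "AE x in lborel. isCont f x"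
  shows "integrable lborel f" "upper_dyadic_sum f \<longlonglongrightarrow> integral\<^sup>L lborel f"
proof -
  from BB_boundedD(1)[OF assms(1)] obtain M where M: "\<And>x. \<bar>f x\<bar> \<le> M"
    by auto
  from BB_boundedD(2)[OF assms(1)] obtain N :: nat where N: "\<And>x. \<bar>x\<bar> > real N \<Longrightarrow> f x = 0"
    by auto
  let ?w = "\<lambda>x. indicator {- real N - 1 .. real N + 1} x * M"
  have w: "integrable lborel ?w"
    by (intro integrable_mult_left) (auto intro!: integrable_real_indicator)
  have bound: "\<bar>upper_step f k x\<bar> \<le> ?w x" for k x
  proof (cases "\<bar>x\<bar> > real N + 1")
    case True
    then have "upper_step f k x = 0"
      by (intro upper_step_eq_0[where R = "real N"] N)
    moreover from True have "x \<notin> {- real N - 1 .. real N + 1}"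
      by auto
    ultimately show ?thesis
      by simp
  next
    case False
    have "\<bar>upper_step f k x\<bar> \<le> M"
      unfolding upper_step_def
      by (rule cSup_abs_le) (auto simp: dyadic_interval_nonempty M)
    moreover from False have "x \<in> {- real N - 1 .. real N + 1}"
      by auto
    ultimately show ?thesis
      by simp
  qed
  have lim: "AE x in lborel. (\<lambda>k. upper_step f k x) \<longlonglongrightarrow> f x"
    using assms(3) by eventually_elim (rule upper_step_tendsto)
  have meas: "f \<in> borel_measurable lborel" "upper_step f k \<in> borel_measurable lborel" for k
    using assms(2) has_bochner_integral_upper_step[OF assms(1), of k]
    by (auto simp: has_bochner_integral_iff)
  have bound': "AE x in lborel. norm (upper_step f k x) \<le> ?w x" for k
    using bound by simp
  show "integrable lborel f"
    using meas w lim bound' by (rule integrable_dominated_convergence)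
  have "(\<lambda>k. integral\<^sup>L lborel (upper_step f k)) \<longlonglongrightarrow> integral\<^sup>L lborel f"
    using meas w lim bound' by (rule integral_dominated_convergence)
  then show "upper_dyadic_sum f \<longlonglongrightarrow> integral\<^sup>L lborel f"
    by (simp add: has_bochner_integral_integral_eq[OF has_bochner_integral_upper_step[OF assms(1)]])
qed

lemma lower_dyadic_sum_eq_uminus_upper:
  "lower_dyadic_sum f k = - upper_dyadic_sum (\<lambda>x. - f x) k"
  by (simp add: lower_dyadic_sum_def upper_dyadic_sum_def Inf_real_def image_image infsum_uminus)

text \<open>This is the sufficiency half of Lebesgue's criterion for Riemann integrability, for Borel
  functions.\<close>

theorem dyadic_integral_eq_lborel:
  assumes "f \<in> BB" "f \<in> borel_measurable borel" "AE x in lborel. isCont f x"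
  shows "f \<in> RI" "dyadic_integral f = integral\<^sup>L lborel f"
proof -
  have upper: "upper_dyadic_sum f \<longlonglongrightarrow> integral\<^sup>L lborel f"
    using assms by (rule upper_dyadic_sum_tendsto_lborel)
  have "AE x in lborel. isCont (\<lambda>x. - f x) x"
    using assms(3) by eventually_elim (rule continuous_minus)
  then have "upper_dyadic_sum (\<lambda>x. - f x) \<longlonglongrightarrow> integral\<^sup>L lborel (\<lambda>x. - f x)"
    using assms by (intro upper_dyadic_sum_tendsto_lborel BB_uminus) auto
  from tendsto_minus[OF this] have lower: "lower_dyadic_sum f \<longlonglongrightarrow> integral\<^sup>L lborel f"
    by (simp add: lower_dyadic_sum_eq_uminus_upper[abs_def])
  show "f \<in> RI" "dyadic_integral f = integral\<^sup>L lborel f"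
    using assms(1) limI[OF upper] limI[OF lower] convergentI[OF upper] convergentI[OF lower]
    by (simp_all add: RI_def dyadic_integral_def)
qed

lemma isCont_mult_indicator:
  fixes g :: "real \<Rightarrow> real"
  assumes "\<And>t. t \<in> {a<..<b} \<Longrightarrow> isCont g t" "x \<noteq> a" "x \<noteq> b"
  shows "isCont (\<lambda>x. g x * indicator {a<..<b} x) x"
proof (cases "x \<in> {a<..<b}")
  case True
  then have "\<forall>\<^sub>F y in nhds x. y \<in> {a<..<b}"
    by (intro eventually_nhds_in_open) auto
  then have "\<forall>\<^sub>F y in nhds x. g y * indicator {a<..<b} y = g y"
    by eventually_elim simp
  from isCont_cong[OF this] assms(1)[OF True] show ?thesis
    by (rule iffD2)
next
  case False
  with assms have "x \<in> - {a..b}"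
    by auto
  then have "\<forall>\<^sub>F y in nhds x. y \<in> - {a..b}"
    by (intro eventually_nhds_in_open) auto
  then have "\<forall>\<^sub>F y in nhds x. g y * indicator {a<..<b} y = 0"
    by eventually_elim auto
  from isCont_cong[OF this] show ?thesis
    by simp
qed

theorem theorem5p2:
  fixes g F :: "real \<Rightarrow> real" and a b :: real
  assumes "a < b"
    and "g \<in> BB"
    and "\<And>t. t \<in> {a<..<b} \<Longrightarrow> isCont g t"
    and "continuous_on {a..b} F"
    and "\<And>t. t \<in> {a<..<b} \<Longrightarrow> (F has_real_derivative g t) (at t)"
  shows "(\<lambda>x. g x * indicator {a<..<b} x) \<in> RI \<and>
         dyadic_integral (\<lambda>x. g x * indicator {a<..<b} x) = F b - F a"
proof -
  let ?h = "\<lambda>x. g x * indicator {a<..<b} x"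
  from BB_boundedD(1)[OF assms(2)] obtain M where M: "\<And>x. \<bar>g x\<bar> \<le> M"
    by auto
  have "\<bar>?h x\<bar> \<le> M" for x
    using M[of x] by (auto simp: indicator_def)
  then have "bounded (range ?h)"
    by (auto simp: bounded_iff)
  moreover have "bounded {a<..<b} \<and> (\<forall>x. x \<notin> {a<..<b} \<longrightarrow> ?h x = 0)"
    by simp
  ultimately have BB: "?h \<in> BB"
    unfolding BB_def by blast
  have "continuous_on {a<..<b} g"
    using assms(3) by (simp add: continuous_on_eq_continuous_at)
  then have meas: "?h \<in> borel_measurable borel"
    using borel_measurable_continuous_on_indicator[of "{a<..<b}" g] by (simp add: mult.commute)
  have "AE x in lborel. x \<noteq> a" "AE x in lborel. x \<noteq> b"
    by (rule AE_lborel_singleton)+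
  then have cont: "AE x in lborel. isCont ?h x"
    by eventually_elim (rule isCont_mult_indicator[OF assms(3)])
  have "(g has_integral F b - F a) {a..b}"
    using assms
    by (intro fundamental_theorem_of_calculus_interior)
      (auto simp: has_real_derivative_iff_has_vector_derivative)
  then have "(g has_integral F b - F a) {a<..<b}"
    using has_integral_open_interval[of g "F b - F a" a b] by simp
  then have "((\<lambda>x. if x \<in> {a<..<b} then g x else 0) has_integral F b - F a) UNIV"
    by (simp only: has_integral_restrict_UNIV)
  also have "(\<lambda>x. if x \<in> {a<..<b} then g x else 0) = ?h"
    by (auto simp: fun_eq_iff)
  finally have "(?h has_integral F b - F a) UNIV" .
  moreover have "(?h has_integral integral\<^sup>L lborel ?h) UNIV"
    using upper_dyadic_sum_tendsto_lborel(1)[OF BB meas cont] by (rule has_integral_integral_lborel)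
  ultimately have "integral\<^sup>L lborel ?h = F b - F a"
    by (rule has_integral_unique[symmetric])
  with dyadic_integral_eq_lborel[OF BB meas cont] show ?thesis
    by simp
qed

end
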